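(* Let $R$ be a positive integer and let $\lambda=(\lambda_1,\lambda_2,\ldots)$ be a sequence of nonnegative numbers, not all zero, with $\sum_i\lambda_i<\infty$ and $\mathrm{DOF}(\lambda)=R$. Then for every integer $r\ge3$, $$\frac{\kappa_r(\chi^*_{\mathrm{std}}(\lambda))}{\kappa_r(\chi^2_{\mathrm{std},R})}\ge1.$$
   Context: $\kappa_r$ denotes the $r$th cumulant. $\chi^*(\lambda)=\sum_i\lambda_iZ_i^2$ with $Z_1,Z_2,\ldots$ independent standard normal random variables, and $\chi^*_{\mathrm{std}}(\lambda)=\dfrac{\chi^*(\lambda)-\sum_i\lambda_i}{\sqrt{2\sum_i\lambda_i^2}}$ is its standardization. $\chi^2_{\mathrm{std},R}$ is the chi-squared random variable with $R$ degrees of freedom standardized to mean $0$ and variance $1$. The spectral degrees of freedom is $\mathrm{DOF}(\lambda)=\dfrac{(\sum_i\lambda_i)^2}{\sum_i\lambda_i^2}$. *)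

theory Defs
  imports "HOL-Probability.Probability"
begin

text \<open>The \<open>r\<close>-th derivative at \<open>0\<close> of the cumulant generating function. It is meaningful
  for random variables whose exponential moments are finite in a neighbourhood of \<open>0\<close>;
  values of the integral outside such a neighbourhood are irrelevant.\<close>

definition cumulant :: "'a measure \<Rightarrow> ('a \<Rightarrow> real) \<Rightarrow> nat \<Rightarrow> real" where
  "cumulant M X r = (deriv ^^ r) (\<lambda>t. ln (prob_space.expectation M (\<lambda>\<omega>. exp (t * X \<omega>)))) 0"

definition standardize :: "'a measure \<Rightarrow> ('a \<Rightarrow> real) \<Rightarrow> 'a \<Rightarrow> real" where
  "standardize M X = (\<lambda>\<omega>. (X \<omega> - prob_space.expectation M X) / sqrt (prob_space.variance M X))"

definition std_normal_rv :: "'a measure \<Rightarrow> ('a \<Rightarrow> real) \<Rightarrow> bool" where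
  "std_normal_rv M X \<longleftrightarrow> distributed M lborel X (\<lambda>x. ennreal (std_normal_density x))"

text \<open>Where the series diverges (a null set when \<open>\<lambda>\<close> is nonnegative and summable and the
  \<open>Z i\<close> are standard normal) the value of \<^const>\<open>suminf\<close> is unspecified.\<close>

definition chi_star :: "(nat \<Rightarrow> 'a \<Rightarrow> real) \<Rightarrow> (nat \<Rightarrow> real) \<Rightarrow> 'a \<Rightarrow> real" where
  "chi_star Z lam = (\<lambda>\<omega>. \<Sum>i. lam i * (Z i \<omega>)\<^sup>2)"

definition chi_star_std :: "(nat \<Rightarrow> 'a \<Rightarrow> real) \<Rightarrow> (nat \<Rightarrow> real) \<Rightarrow> 'a \<Rightarrow> real" where
  "chi_star_std Z lam =
     (\<lambda>\<omega>. (chi_star Z lam \<omega> - (\<Sum>i. lam i)) / sqrt (2 * (\<Sum>i. (lam i)\<^sup>2)))"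

definition DOF :: "(nat \<Rightarrow> real) \<Rightarrow> real" where
  "DOF lam = (\<Sum>i. lam i)\<^sup>2 / (\<Sum>i. (lam i)\<^sup>2)"

definition chi_squared_measure :: "nat \<Rightarrow> real measure" where
  "chi_squared_measure R =
     distr (\<Pi>\<^sub>M i\<in>{..<R}. density lborel (\<lambda>x. ennreal (std_normal_density x))) borel
       (\<lambda>z. \<Sum>i<R. (z i)\<^sup>2)"

definition chi_squared_rv :: "'a measure \<Rightarrow> nat \<Rightarrow> ('a \<Rightarrow> real) \<Rightarrow> bool" where
  "chi_squared_rv M R X \<longleftrightarrow> X \<in> borel_measurable M \<and> distr M borel X = chi_squared_measure R"

end

theory Submission
  imports Defs
begin

text \<open>
  If \<open>Z\<close> is standard normal and \<open>c < 1/2\<close>, then \<open>E exp (c Z\<^sup>2) = (1 - 2 c) powr (-1/2)\<close>. By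
  independence the cumulant generating function of \<open>\<Sum>\<^sub>i \<lambda>\<^sub>i Z\<^sub>i\<^sup>2\<close> near \<open>0\<close> is
  \<open>\<Sum>\<^sub>i - ln (1 - 2 t \<lambda>\<^sub>i) / 2\<close>. Expanding the logarithms and exchanging the two summations
  gives the power series with coefficient \<open>2^k / (2 k) * \<Sum>\<^sub>i \<lambda>\<^sub>i^k\<close> at \<open>t^k\<close> for \<open>k \<ge> 1\<close>, so
  that \<open>\<kappa>\<^sub>r = r! 2^r / (2 r) * \<Sum>\<^sub>i \<lambda>\<^sub>i^r\<close>. A shift changes only the first
  cumulant, and division by the standard deviation \<open>s\<close> divides the \<open>r\<close>-th one by \<open>s^r\<close>.

  The chi-squared variable is the case of \<open>R\<close> weights equal to \<open>1\<close>. Write \<open>A\<close>, \<open>B\<close>, \<open>C\<close> for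
  the sums of the first, second and \<open>r\<close>-th powers of the weights. Since \<open>A\<^sup>2 = R B\<close>, the ratio of
  the two standardized cumulants is \<open>C A^(r-2) / B^(r-1)\<close>. That this is at least \<open>1\<close> is Jensen's
  inequality for the function \<open>x^(r-1)\<close> and the probability weights \<open>\<lambda>\<^sub>i / A\<close>, whose mean of
  \<open>\<lambda>\<close> is \<open>B / A\<close> (lemma \<open>power_sum_inequality\<close>).

  The infinite sum requires one limit argument (lemma \<open>mgf_chi_star\<close>): the series converges
  almost surely because its expectation \<open>A\<close> is finite, and for small \<open>t\<close> the variable
  \<open>exp (\<bar>t\<bar> \<Sum>\<^sub>i \<lambda>\<^sub>i Z\<^sub>i\<^sup>2)\<close> is integrable by Fatou's lemma and dominates the
  exponentials of all partial sums.
\<close>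

section \<open>Power sums of a nonnegative sequence\<close>

lemma summable_power:
  fixes x :: "nat \<Rightarrow> real"
  assumes nonneg: "\<And>i. x i \<ge> 0" and "summable x" and "n > 0"
  shows "summable (\<lambda>i. x i ^ n)"
proof (rule summable_comparison_test_ev)
  have "x \<longlonglongrightarrow> 0"
    using \<open>summable x\<close> by (rule summable_LIMSEQ_zero)
  then have "\<forall>\<^sub>F i in sequentially. x i < 1"
    by (rule order_tendstoD) simp
  then show "\<forall>\<^sub>F i in sequentially. norm (x i ^ n) \<le> x i"
  proof eventually_elim
    case (elim i)
    then show ?case
      using nonneg[of i] \<open>n > 0\<close> power_decreasing[of 1 n "x i"] by simp
  qed
qed fact

text \<open>
  Jensen's inequality for \<open>y^(n+1)\<close> with weights proportional to \<open>x\<^sub>i\<close>. It comes from the tangent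
  line of \<open>y^(n+1)\<close> at the weighted mean \<open>m\<close>, which is Bernoulli's inequality for \<open>x\<^sub>i / m\<close>: after
  multiplication by \<open>x\<^sub>i\<close> and summation the linear term vanishes.
\<close>

lemma power_sum_inequality:
  fixes x :: "nat \<Rightarrow> real"
  assumes nonneg: "\<And>i. x i \<ge> 0" and summ: "summable x"
  shows "(\<Sum>i. (x i)\<^sup>2) ^ (n + 1) \<le> (\<Sum>i. x i ^ (n + 2)) * (\<Sum>i. x i) ^ n"
proof (cases "\<forall>i. x i = 0")
  case False
  define A where "A = (\<Sum>i. x i)"
  define B where "B = (\<Sum>i. (x i)\<^sup>2)"
  define m where "m = B / A"
  note powers = summable_power[OF nonneg summ]
  obtain j where "x j > 0"
    using False nonneg by (metis less_eq_real_def)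
  then have pos: "A > 0" "B > 0"
    unfolding A_def B_def using nonneg summ powers[of 2] by (auto intro!: suminf_pos2[of _ j])
  then have "m > 0"
    by (simp add: m_def)
  have "x i * (1 + real (n + 1) * (x i / m - 1)) \<le> x i * (x i / m) ^ (n + 1)" for i
    using Bernoulli_inequality[of "x i / m - 1" "n + 1"] nonneg[of i] \<open>m > 0\<close>
    by (intro mult_left_mono) auto
  then have le: "x i + real (n + 1) * ((x i)\<^sup>2 / m - x i) \<le> x i ^ (n + 2) / m ^ (n + 1)" for i
    by (simp add: power_divide algebra_simps power2_eq_square)
  have "(\<lambda>i. x i + real (n + 1) * ((x i)\<^sup>2 / m - x i)) sums (A + real (n + 1) * (B / m - A))"
    unfolding A_def B_def by (intro sums_add sums_mult sums_diff sums_divide summable_sums summ powers) auto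
  moreover have "(\<lambda>i. x i ^ (n + 2) / m ^ (n + 1)) sums ((\<Sum>i. x i ^ (n + 2)) / m ^ (n + 1))"
    by (intro sums_divide summable_sums powers) auto
  ultimately have "A + real (n + 1) * (B / m - A) \<le> (\<Sum>i. x i ^ (n + 2)) / m ^ (n + 1)"
    by (rule sums_le[OF le])
  moreover have "B / m = A"
    using pos by (simp add: m_def)
  ultimately have "A * m ^ (n + 1) \<le> (\<Sum>i. x i ^ (n + 2))"
    using \<open>m > 0\<close> by (simp add: field_simps)
  then have "(A * m ^ (n + 1)) * A ^ n \<le> (\<Sum>i. x i ^ (n + 2)) * A ^ n"
    using pos by (intro mult_right_mono) auto
  also have "(A * m ^ (n + 1)) * A ^ n = (m * A) ^ (n + 1)"
    by (simp add: power_mult_distrib)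
  also have "m * A = B"
    using pos by (simp add: m_def)
  finally show ?thesis
    by (simp add: A_def B_def)
qed simp

section \<open>Cumulants from a power series\<close>

text \<open>Termwise differentiation keeps the interval of convergence, so induction on \<open>r\<close> over all
  pairs of a function and its coefficients never shrinks \<open>d\<close>.\<close>

lemma deriv_power_series_at_0:
  fixes f :: "real \<Rightarrow> real"
  assumes "\<And>t. \<bar>t\<bar> < d \<Longrightarrow> (\<lambda>k. c k * t ^ k) sums f t" and "d > 0"
  shows "(deriv ^^ r) f 0 = fact r * c r"
  using assms(1)
proof (induction r arbitrary: f c)
  case 0
  from 0[of 0] \<open>d > 0\<close> show ?case
    using sums_unique2[OF powser_sums_zero[of c]] by fastforce
next
  case (Suc r)
  have summ: "summable (\<lambda>k. c k * t ^ k)" if "norm t < d" for t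
    using Suc.prems[of t] that by (auto dest: sums_summable)
  have "(\<lambda>k. diffs c k * t ^ k) sums deriv f t" if t: "\<bar>t\<bar> < d" for t
  proof -
    have "((\<lambda>t. \<Sum>k. c k * t ^ k) has_field_derivative (\<Sum>k. diffs c k * t ^ k)) (at t)"
      using summ t by (intro termdiffs_strong'[where K = d]) auto
    moreover have "\<forall>\<^sub>F s in nhds t. (\<Sum>k. c k * s ^ k) = f s"
      using t Suc.prems
      by (intro eventually_nhds_in_open[of "{-d<..<d}", THEN eventually_mono])
         (auto simp: sums_iff abs_less_iff)
    ultimately have "(f has_field_derivative (\<Sum>k. diffs c k * t ^ k)) (at t)"
      by (subst (asm) DERIV_cong_ev[OF refl _ refl])
    then have "deriv f t = (\<Sum>k. diffs c k * t ^ k)"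
      by (rule DERIV_imp_deriv)
    moreover have "summable (\<lambda>k. diffs c k * t ^ k)"
      using summ t by (intro termdiff_converges[where K = d]) auto
    ultimately show ?thesis
      by (simp add: sums_iff)
  qed
  from Suc.IH[OF this] show ?case
    by (simp add: funpow_Suc_right diffs_def algebra_simps del: funpow.simps)
qed

text \<open>The shift by \<open>a\<close> contributes the linear term \<open>- a t / s\<close> to the cumulant generating
  function, which is invisible to the derivatives of order \<open>r \<ge> 2\<close>.\<close>

lemma cumulant_affine:
  fixes Y :: "'a \<Rightarrow> real"
  assumes mgf: "\<And>t. \<bar>t\<bar> < d \<Longrightarrow> (\<integral>\<omega>. exp (t * Y \<omega>) \<partial>M) = exp (\<Sum>k. c k * t ^ k)"
    and summ: "\<And>t. \<bar>t\<bar> < d \<Longrightarrow> summable (\<lambda>k. c k * t ^ k)"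
    and "d > 0" "s > 0" "r \<ge> 2"
  shows "cumulant M (\<lambda>\<omega>. (Y \<omega> - a) / s) r = fact r * c r / s ^ r"
proof -
  define L where "L t = (\<Sum>k. c k * t ^ k)" for t
  have L: "(\<lambda>k. c k * t ^ k) sums L t" if "\<bar>t\<bar> < d" for t
    unfolding L_def using summ[OF that] by (rule summable_sums)
  define c' where "c' k = c k / s ^ k + (if k = 1 then - a / s else 0)" for k
  have "(\<lambda>k. c' k * t ^ k) sums ln (\<integral>\<omega>. exp (t * ((Y \<omega> - a) / s)) \<partial>M)" if t: "\<bar>t\<bar> < d * s" for t
  proof -
    have ts: "\<bar>t / s\<bar> < d"
      using t \<open>s > 0\<close> by (simp add: abs_divide divide_simps)
    have "(\<integral>\<omega>. exp (t * ((Y \<omega> - a) / s)) \<partial>M) = (\<integral>\<omega>. exp (- a / s * t) * exp (t / s * Y \<omega>) \<partial>M)"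
      by (intro Bochner_Integration.integral_cong refl)
         (simp add: mult_exp_exp diff_divide_distrib algebra_simps)
    also have "\<dots> = exp (L (t / s) + (- a / s) * t)"
      by (simp only: integral_mult_right_zero mgf[OF ts, folded L_def] exp_add) (simp only: mult.commute)
    finally have "ln (\<integral>\<omega>. exp (t * ((Y \<omega> - a) / s)) \<partial>M) = L (t / s) + (- a / s) * t"
      by simp
    moreover have "(\<lambda>k. c k * (t / s) ^ k + (if k = 1 then (- a / s) * t else 0)) sums
        (L (t / s) + (- a / s) * t)"
      by (intro sums_add L[OF ts] sums_single[of 1 "\<lambda>_. (- a / s) * t"])
    moreover have "c k * (t / s) ^ k + (if k = 1 then (- a / s) * t else 0) = c' k * t ^ k" for k
      by (simp add: c'_def power_divide distrib_right)
    ultimately show ?thesis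
      by simp
  qed
  from deriv_power_series_at_0[OF this, where r = r] assms show ?thesis
    by (simp add: cumulant_def c'_def)
qed

section \<open>The cumulant generating function of a weighted sum of squares\<close>

text \<open>The coefficients of the power series at \<open>0\<close> of \<open>\<Sum>\<^sub>i - ln (1 - 2 t \<lambda>\<^sub>i) / 2\<close>. The
  coefficient for \<open>k = 0\<close> is \<open>0\<close> as it must be, because of the convention \<open>x / 0 = 0\<close>; this also
  disposes of the divergent sum \<open>\<Sum>\<^sub>i \<lambda>\<^sub>i^0\<close>.\<close>

definition cgf_coeff :: "(nat \<Rightarrow> real) \<Rightarrow> nat \<Rightarrow> real" where
  "cgf_coeff lam k = 2 ^ k / (2 * real k) * (\<Sum>i. lam i ^ k)"

lemma scaled_weight_le:
  fixes lam :: "nat \<Rightarrow> real"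
  assumes nonneg: "\<And>i. lam i \<ge> 0" and summ: "summable lam"
    and t: "\<bar>t\<bar> * (4 * (\<Sum>i. lam i)) < 1"
  shows "\<bar>t\<bar> * lam i \<le> 1/4"
proof -
  have "lam i \<le> (\<Sum>i. lam i)"
    using sum_le_suminf[OF summ, of "{i}"] nonneg by simp
  then have "\<bar>t\<bar> * lam i \<le> \<bar>t\<bar> * (\<Sum>i. lam i)"
    by (intro mult_left_mono) auto
  then show ?thesis
    using t by simp
qed

text \<open>The bound on \<open>t\<close> keeps every \<open>\<bar>2 t \<lambda>\<^sub>i\<bar>\<close> below \<open>1/2\<close>, well inside the disc of convergence
  of the logarithm. This uniform distance from the boundary is what permits exchanging the sums
  over \<open>i\<close> and \<open>k\<close>.\<close>

lemma cgf_expansion: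
  fixes lam :: "nat \<Rightarrow> real"
  assumes nonneg: "\<And>i. lam i \<ge> 0" and summ: "summable lam"
    and t: "\<bar>t\<bar> * (4 * (\<Sum>i. lam i)) < 1"
  shows "summable (\<lambda>k. cgf_coeff lam k * t ^ k)"
    and "(\<lambda>i. - ln (1 - 2 * (t * lam i)) / 2) sums (\<Sum>k. cgf_coeff lam k * t ^ k)"
proof -
  let ?f = "\<lambda>(i, k). (2 * (t * lam i)) ^ k / (2 * real k)"
  have half: "2 * \<bar>t * lam i\<bar> \<le> 1/2" for i
    using scaled_weight_le[OF nonneg summ t, of i] nonneg[of i] by (simp add: abs_mult)
  (* The geometric factor 1/2 and the summable factor lam i make the double series absolutely
     summable; the term for k = 0 vanishes because division by zero yields zero. *)
  have bound: "norm (?f (i, k)) \<le> 4 * \<bar>t\<bar> * lam i * (1/2) ^ k" for i k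
  proof (cases k)
    case (Suc j)
    have "norm (?f (i, k)) = (2 * \<bar>t * lam i\<bar>) ^ k / (2 * real k)"
      by (simp add: abs_mult power_abs)
    also have "\<dots> \<le> (2 * \<bar>t * lam i\<bar>) ^ k / 1"
      by (intro divide_left_mono) (auto simp: Suc)
    also have "\<dots> = (2 * \<bar>t * lam i\<bar>) * (2 * \<bar>t * lam i\<bar>) ^ j"
      by (simp add: Suc)
    also have "\<dots> \<le> (2 * \<bar>t * lam i\<bar>) * (1/2) ^ j"
      by (intro mult_left_mono power_mono half) auto
    also have "\<dots> = 4 * \<bar>t\<bar> * lam i * (1/2) ^ k"
      using nonneg[of i] by (simp add: Suc abs_mult)
    finally show ?thesis .
  qed (use nonneg[of i] in simp)
  have "(\<lambda>(i, k). 4 * \<bar>t\<bar> * lam i * (1/2) ^ k) summable_on UNIV \<times> UNIV"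
  proof (rule summable_on_SigmaI)
    show "((\<lambda>k. case (i, k) of (i, k) \<Rightarrow> 4 * \<bar>t\<bar> * lam i * (1/2) ^ k) has_sum
        4 * \<bar>t\<bar> * lam i * 2) (UNIV :: nat set)" for i
    proof (rule norm_summable_imp_has_sum)
      have "(\<lambda>k. 4 * \<bar>t\<bar> * lam i * (1/2) ^ k) sums (4 * \<bar>t\<bar> * lam i * (1 / (1 - 1/2)))"
        by (intro sums_mult geometric_sums) auto
      then show sums: "(\<lambda>k. case (i, k) of (i, k) \<Rightarrow> 4 * \<bar>t\<bar> * lam i * (1/2) ^ k) sums (4 * \<bar>t\<bar> * lam i * 2)"
        by simp
      show "summable (\<lambda>k. norm (case (i, k) of (i, k) \<Rightarrow> 4 * \<bar>t\<bar> * lam i * (1/2) ^ k))"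
        using sums_summable[OF sums] nonneg[of i] by (simp add: abs_mult)
    qed
    show "(\<lambda>i. 4 * \<bar>t\<bar> * lam i * 2) summable_on UNIV"
      using nonneg summ by (intro norm_summable_imp_summable_on) (auto simp: abs_mult)
  qed (use nonneg in auto)
  then have "?f summable_on UNIV \<times> UNIV"
  proof (rule abs_summable_summable[OF summable_on_comparison_test])
    show "norm (?f p) \<le> (case p of (i, k) \<Rightarrow> 4 * \<bar>t\<bar> * lam i * (1/2) ^ k)" for p
      using bound[of "fst p" "snd p"] by (simp add: case_prod_unfold)
  qed auto
  then obtain L where L: "(?f has_sum L) (UNIV \<times> UNIV)"
    by (auto simp: summable_on_def)
  have "((\<lambda>k. ?f (i, k)) has_sum (- ln (1 - 2 * (t * lam i)) / 2)) UNIV" for i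
  proof (rule norm_summable_imp_has_sum)
    show "summable (\<lambda>k. norm (?f (i, k)))"
      by (rule summable_comparison_test'[where g = "\<lambda>k. 4 * \<bar>t\<bar> * lam i * (1/2) ^ k"])
         (use bound in \<open>auto intro!: summable_mult summable_geometric\<close>)
    have "(\<lambda>k. - (- ((- (- (2 * (t * lam i)))) ^ k) / real k) / 2) sums (- ln (1 + (- (2 * (t * lam i)))) / 2)"
      using half[of i] by (intro sums_divide sums_minus ln_series') auto
    then show "(\<lambda>k. ?f (i, k)) sums (- ln (1 - 2 * (t * lam i)) / 2)"
      by (simp add: mult.commute)
  qed
  then have "((\<lambda>i. - ln (1 - 2 * (t * lam i)) / 2) has_sum L) UNIV"
    by (intro has_sum_SigmaD[OF L])
  moreover have "((\<lambda>k. cgf_coeff lam k * t ^ k) has_sum L) UNIV"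
  proof (rule has_sum_SigmaD)
    show "((\<lambda>(k, i). ?f (i, k)) has_sum L) (UNIV \<times> UNIV)"
      using L by (subst (asm) has_sum_swap)
    show "((\<lambda>i. case (k, i) of (k, i) \<Rightarrow> ?f (i, k)) has_sum (cgf_coeff lam k * t ^ k)) UNIV" for k
    proof (cases "k = 0")
      case False
      have "((\<lambda>i. lam i ^ k) has_sum (\<Sum>i. lam i ^ k)) UNIV"
        using nonneg summable_power[OF nonneg summ, of k] False
        by (intro norm_summable_imp_has_sum) (auto simp: power_abs)
      from has_sum_cmult_right[OF this, of "(2 * t) ^ k / (2 * real k)"] show ?thesis
        by (simp add: cgf_coeff_def power_mult_distrib mult_ac)
    qed (simp add: cgf_coeff_def)
  qed
  ultimately have "(\<lambda>i. - ln (1 - 2 * (t * lam i)) / 2) sums L" "(\<lambda>k. cgf_coeff lam k * t ^ k) sums L"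
    by (auto intro: has_sum_imp_sums)
  then show "summable (\<lambda>k. cgf_coeff lam k * t ^ k)"
    and "(\<lambda>i. - ln (1 - 2 * (t * lam i)) / 2) sums (\<Sum>k. cgf_coeff lam k * t ^ k)"
    by (auto simp: sums_iff)
qed

section \<open>Squares of independent standard normal variables\<close>

text \<open>Up to the factor \<open>s\<close>, the integrand is the centred normal density with standard deviation
  \<open>s = 1 / sqrt (1 - 2 c)\<close>. The value \<open>s\<close> is written as an exponential so that products over
  independent variables become sums.\<close>

lemma std_normal_exp_square:
  fixes c :: real
  assumes "c < 1/2"
  shows "has_bochner_integral lborel (\<lambda>x. std_normal_density x * exp (c * x\<^sup>2)) (exp (- ln (1 - 2 * c) / 2))"
proof -
  define s where "s = 1 / sqrt (1 - 2 * c)"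
  have s: "s > 0" "s\<^sup>2 = 1 / (1 - 2 * c)"
    using assms by (auto simp: s_def power_divide)
  have "exp (- (ln (1 - 2 * c) / 2)) = s"
    using assms by (simp add: s_def exp_minus ln_sqrt[symmetric] inverse_eq_divide)
  moreover have "has_bochner_integral lborel (\<lambda>x. s * normal_density 0 s x) (s * 1)"
    using s by (intro has_bochner_integral_mult_right) (simp add: has_bochner_integral_iff)
  moreover have "s * normal_density 0 s x = std_normal_density x * exp (c * x\<^sup>2)" for x
  proof -
    have "- x\<^sup>2 / (2 * s\<^sup>2) = - x\<^sup>2 / 2 + c * x\<^sup>2"
      using assms by (simp add: s field_simps)
    moreover have "sqrt (2 * pi * s\<^sup>2) = sqrt (2 * pi) * s"
      using s(1) by (simp add: real_sqrt_mult)
    ultimately show ?thesis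
      using s(1) by (simp add: normal_density_def mult_exp_exp)
  qed
  ultimately show ?thesis
    by simp
qed

lemma std_normal_rv_measurable: "std_normal_rv M Z \<Longrightarrow> Z \<in> borel_measurable M"
  by (simp add: std_normal_rv_def distributed_def)

context prob_space
begin

lemma std_normal_rv_expectation:
  assumes "std_normal_rv M Z" "g \<in> borel_measurable borel"
    and "has_bochner_integral lborel (\<lambda>x. std_normal_density x * g x) v"
  shows "integrable M (\<lambda>\<omega>. g (Z \<omega>))" "expectation (\<lambda>\<omega>. g (Z \<omega>)) = v"
  using assms distributed_integrable[of M lborel Z std_normal_density g]
    distributed_integral[of M lborel Z std_normal_density g]
  by (auto simp: std_normal_rv_def has_bochner_integral_iff)

lemma std_normal_rv_moments:
  assumes "std_normal_rv M Z"
  shows "integrable M (\<lambda>\<omega>. (Z \<omega>)\<^sup>2)" "expectation (\<lambda>\<omega>. (Z \<omega>)\<^sup>2) = 1"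
    "integrable M (\<lambda>\<omega>. (Z \<omega>) ^ 4)" "expectation (\<lambda>\<omega>. (Z \<omega>) ^ 4) = 3"
  using std_normal_rv_expectation[OF assms _ std_normal_moment_even[of 1]]
    std_normal_rv_expectation[OF assms _ std_normal_moment_even[of 2]]
  by (simp_all add: fact_numeral)

lemma mgf_finite_sum_squares:
  assumes "finite I" "indep_vars (\<lambda>_. borel) Z I" "\<And>i. i \<in> I \<Longrightarrow> std_normal_rv M (Z i)"
    and "\<And>i. i \<in> I \<Longrightarrow> c i < 1/2"
  shows "integrable M (\<lambda>\<omega>. exp (\<Sum>i\<in>I. c i * (Z i \<omega>)\<^sup>2))"
    and "expectation (\<lambda>\<omega>. exp (\<Sum>i\<in>I. c i * (Z i \<omega>)\<^sup>2)) = exp (\<Sum>i\<in>I. - ln (1 - 2 * c i) / 2)"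
proof -
  have indep: "indep_vars (\<lambda>_. borel) (\<lambda>i \<omega>. exp (c i * (Z i \<omega>)\<^sup>2)) I"
    using assms by (intro indep_vars_compose2[OF assms(2)]) auto
  have single: "integrable M (\<lambda>\<omega>. exp (c i * (Z i \<omega>)\<^sup>2))"
    "expectation (\<lambda>\<omega>. exp (c i * (Z i \<omega>)\<^sup>2)) = exp (- ln (1 - 2 * c i) / 2)" if "i \<in> I" for i
    using std_normal_rv_expectation[OF assms(3)[OF that] _ std_normal_exp_square[OF assms(4)[OF that]]]
    by auto
  show "integrable M (\<lambda>\<omega>. exp (\<Sum>i\<in>I. c i * (Z i \<omega>)\<^sup>2))"
    using indep_vars_integrable[OF \<open>finite I\<close> indep single(1)] by (simp add: exp_sum \<open>finite I\<close>)
  show "expectation (\<lambda>\<omega>. exp (\<Sum>i\<in>I. c i * (Z i \<omega>)\<^sup>2)) = exp (\<Sum>i\<in>I. - ln (1 - 2 * c i) / 2)"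
    using indep_vars_lebesgue_integral[OF \<open>finite I\<close> indep single(1)] single(2)
    by (simp add: exp_sum \<open>finite I\<close>)
qed

text \<open>The series has the finite expectation \<open>\<Sum>\<^sub>i \<lambda>\<^sub>i\<close>, hence is finite almost everywhere.\<close>

lemma AE_summable_chi_star:
  assumes "\<And>i. std_normal_rv M (Z i)" "\<And>i. lam i \<ge> 0" "summable lam"
  shows "AE \<omega> in M. summable (\<lambda>i. lam i * (Z i \<omega>)\<^sup>2)"
proof -
  have [measurable]: "Z i \<in> borel_measurable M" for i
    using assms(1) by (rule std_normal_rv_measurable)
  have "(\<integral>\<^sup>+\<omega>. ennreal (lam i * (Z i \<omega>)\<^sup>2) \<partial>M) = ennreal (lam i)" for i
    using std_normal_rv_moments[OF assms(1)] assms(2) by (subst nn_integral_eq_integral) auto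
  then have "(\<integral>\<^sup>+\<omega>. (\<Sum>i. ennreal (lam i * (Z i \<omega>)\<^sup>2)) \<partial>M) = (\<Sum>i. ennreal (lam i))"
    by (subst nn_integral_suminf) auto
  also have "\<dots> = ennreal (\<Sum>i. lam i)"
    using assms by (intro suminf_ennreal2) auto
  finally have "AE \<omega> in M. (\<Sum>i. ennreal (lam i * (Z i \<omega>)\<^sup>2)) \<noteq> \<infinity>"
    by (intro nn_integral_PInf_AE) auto
  then show ?thesis
    by eventually_elim (use assms in \<open>auto intro!: summable_suminf_not_top\<close>)
qed

text \<open>Dominated convergence along the partial sums. The value \<open>\<bar>t\<bar>\<close> occurs beside \<open>t\<close> because
  \<open>exp (\<bar>t\<bar> * chi_star Z lam \<omega>)\<close> is the dominating function; its integral is bounded by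
  \<open>exp L'\<close>.\<close>

lemma mgf_chi_star:
  assumes indep: "indep_vars (\<lambda>_. borel) Z UNIV" and normal: "\<And>i. std_normal_rv M (Z i)"
    and nonneg: "\<And>i. lam i \<ge> 0" and summ: "summable lam"
    and small: "\<And>i. \<bar>t\<bar> * lam i < 1/2"
    and L: "(\<lambda>i. - ln (1 - 2 * (t * lam i)) / 2) sums L"
    and L': "(\<lambda>i. - ln (1 - 2 * (\<bar>t\<bar> * lam i)) / 2) sums L'"
  shows "expectation (\<lambda>\<omega>. exp (t * chi_star Z lam \<omega>)) = exp L"
proof -
  have [measurable]: "Z i \<in> borel_measurable M" for i
    using normal by (rule std_normal_rv_measurable)
  define S where "S n \<omega> = (\<Sum>i<n. lam i * (Z i \<omega>)\<^sup>2)" for n \<omega>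
  have [measurable]: "S n \<in> borel_measurable M" "chi_star Z lam \<in> borel_measurable M" for n
    by (auto simp: S_def[abs_def] chi_star_def[abs_def])
  have small': "s * lam i < 1/2" if "s \<in> {t, \<bar>t\<bar>}" for s i
  proof -
    have "s * lam i \<le> \<bar>t\<bar> * lam i"
      using that nonneg by (intro mult_right_mono) auto
    then show ?thesis
      using small[of i] by simp
  qed
  have partial: "integrable M (\<lambda>\<omega>. exp (s * S n \<omega>))"
    "expectation (\<lambda>\<omega>. exp (s * S n \<omega>)) = exp (\<Sum>i<n. - ln (1 - 2 * (s * lam i)) / 2)"
    if "s \<in> {t, \<bar>t\<bar>}" for s n
    using mgf_finite_sum_squares[OF _ indep_vars_subset[OF indep] normal small'[OF that], of "{..<n}"]
    by (auto simp: S_def sum_distrib_left mult.assoc)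
  have "AE \<omega> in M. summable (\<lambda>i. lam i * (Z i \<omega>)\<^sup>2)"
    using normal nonneg summ by (rule AE_summable_chi_star)
  then have lim: "AE \<omega> in M. (\<lambda>n. S n \<omega>) \<longlonglongrightarrow> chi_star Z lam \<omega> \<and> (\<forall>n. S n \<omega> \<le> chi_star Z lam \<omega>)"
  proof eventually_elim
    case (elim \<omega>)
    then show ?case
      using nonneg unfolding S_def chi_star_def
      by (auto intro!: summable_LIMSEQ sum_le_suminf)
  qed
  have dom: "integrable M (\<lambda>\<omega>. exp (\<bar>t\<bar> * chi_star Z lam \<omega>))"
  proof (rule integrableI_nonneg)
    have "AE \<omega> in M. ennreal (exp (\<bar>t\<bar> * chi_star Z lam \<omega>)) =
        liminf (\<lambda>n. ennreal (exp (\<bar>t\<bar> * S n \<omega>)))"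
      using lim
    proof eventually_elim
      case (elim \<omega>)
      then have "(\<lambda>n. ennreal (exp (\<bar>t\<bar> * S n \<omega>))) \<longlonglongrightarrow> ennreal (exp (\<bar>t\<bar> * chi_star Z lam \<omega>))"
        by (intro tendsto_intros) auto
      then show ?case
        by (intro lim_imp_Liminf[symmetric]) auto
    qed
    then have "(\<integral>\<^sup>+\<omega>. ennreal (exp (\<bar>t\<bar> * chi_star Z lam \<omega>)) \<partial>M) =
        (\<integral>\<^sup>+\<omega>. liminf (\<lambda>n. ennreal (exp (\<bar>t\<bar> * S n \<omega>))) \<partial>M)"
      by (rule nn_integral_cong_AE)
    also have "\<dots> \<le> liminf (\<lambda>n. \<integral>\<^sup>+\<omega>. ennreal (exp (\<bar>t\<bar> * S n \<omega>)) \<partial>M)"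
      by (intro nn_integral_liminf) auto
    also have "(\<lambda>n. \<integral>\<^sup>+\<omega>. ennreal (exp (\<bar>t\<bar> * S n \<omega>)) \<partial>M) =
        (\<lambda>n. ennreal (exp (\<Sum>i<n. - ln (1 - 2 * (\<bar>t\<bar> * lam i)) / 2)))"
      using partial[of "\<bar>t\<bar>"] by (subst nn_integral_eq_integral) auto
    also have "liminf \<dots> = ennreal (exp L')"
      using L' unfolding sums_def by (intro lim_imp_Liminf tendsto_intros) auto
    finally show "(\<integral>\<^sup>+\<omega>. ennreal (exp (\<bar>t\<bar> * chi_star Z lam \<omega>)) \<partial>M) < \<infinity>"
      by (simp add: order_le_less_trans)
  qed auto
  have "(\<lambda>n. expectation (\<lambda>\<omega>. exp (t * S n \<omega>))) \<longlonglongrightarrow> expectation (\<lambda>\<omega>. exp (t * chi_star Z lam \<omega>))"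
  proof (rule integral_dominated_convergence[OF _ _ dom])
    show "AE \<omega> in M. (\<lambda>n. exp (t * S n \<omega>)) \<longlonglongrightarrow> exp (t * chi_star Z lam \<omega>)"
      using lim by eventually_elim (auto intro!: tendsto_intros)
    show "AE \<omega> in M. norm (exp (t * S n \<omega>)) \<le> exp (\<bar>t\<bar> * chi_star Z lam \<omega>)" for n
      using lim
    proof eventually_elim
      case (elim \<omega>)
      have "S n \<omega> \<ge> 0"
        using nonneg by (auto simp: S_def intro!: sum_nonneg)
      then have "t * S n \<omega> \<le> \<bar>t\<bar> * S n \<omega>"
        by (intro mult_right_mono) auto
      also have "\<dots> \<le> \<bar>t\<bar> * chi_star Z lam \<omega>"
        using elim by (intro mult_left_mono) auto
      finally show ?case
        by simp
    qed
  qed auto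
  moreover have "(\<lambda>n. expectation (\<lambda>\<omega>. exp (t * S n \<omega>))) \<longlonglongrightarrow> exp L"
    using L partial(2)[of t] unfolding sums_def by (auto intro: tendsto_intros)
  ultimately show ?thesis
    by (rule LIMSEQ_unique)
qed

text \<open>The variables \<open>Z\<^sub>i\<^sup>2 - 1\<close> are centred, independent and of variance \<open>E Z\<^sup>4 - 1 = 2\<close>, so only
  the diagonal terms of the squared sum contribute.\<close>

lemma sum_squares_moments:
  assumes "finite I" and indep: "indep_vars (\<lambda>_. borel) Z I"
    and normal: "\<And>i. i \<in> I \<Longrightarrow> std_normal_rv M (Z i)"
  shows "expectation (\<lambda>\<omega>. \<Sum>i\<in>I. (Z i \<omega>)\<^sup>2) = real (card I)"
    and "expectation (\<lambda>\<omega>. ((\<Sum>i\<in>I. (Z i \<omega>)\<^sup>2) - real (card I))\<^sup>2) = 2 * real (card I)"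
proof -
  note moments = std_normal_rv_moments[OF normal]
  show "expectation (\<lambda>\<omega>. \<Sum>i\<in>I. (Z i \<omega>)\<^sup>2) = real (card I)"
    using moments by (subst Bochner_Integration.integral_sum) auto
  define W where "W i \<omega> = (Z i \<omega>)\<^sup>2 - 1" for i \<omega>
  have W: "integrable M (W i)" "expectation (W i) = 0" if "i \<in> I" for i
    using moments[OF that] by (auto simp: W_def[abs_def] prob_space)
  have indep_W: "indep_vars (\<lambda>_. borel) W I"
    unfolding W_def[abs_def] by (intro indep_vars_compose2[OF indep]) auto
  have prod: "integrable M (\<lambda>\<omega>. W i \<omega> * W j \<omega>)"
    "expectation (\<lambda>\<omega>. W i \<omega> * W j \<omega>) = (if i = j then 2 else 0)" if "i \<in> I" "j \<in> I" for i j
  proof -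
    have "integrable M (\<lambda>\<omega>. W i \<omega> * W j \<omega>) \<and>
      expectation (\<lambda>\<omega>. W i \<omega> * W j \<omega>) = (if i = j then 2 else 0)"
    proof (cases "i = j")
      case True
      have "W i \<omega> * W j \<omega> = Z i \<omega> ^ 4 - 2 * (Z i \<omega>)\<^sup>2 + 1" for \<omega>
        by (simp add: True W_def power2_eq_square power4_eq_xxxx algebra_simps)
      then show ?thesis
        using moments[OF \<open>i \<in> I\<close>] by (simp add: True prob_space)
    next
      case False
      have *: "indep_vars (\<lambda>_. borel) W {i, j}"
        using that by (intro indep_vars_subset[OF indep_W]) auto
      show ?thesis
        using indep_vars_lebesgue_integral[OF _ *] indep_vars_integrable[OF _ *] W that False
        by auto
    qed
    then show "integrable M (\<lambda>\<omega>. W i \<omega> * W j \<omega>)"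
      "expectation (\<lambda>\<omega>. W i \<omega> * W j \<omega>) = (if i = j then 2 else 0)"
      by auto
  qed
  have "((\<Sum>i\<in>I. (Z i \<omega>)\<^sup>2) - real (card I))\<^sup>2 = (\<Sum>i\<in>I. \<Sum>j\<in>I. W i \<omega> * W j \<omega>)" for \<omega>
    by (simp add: power2_eq_square sum_product[symmetric]) (simp add: W_def sum_subtractf power2_eq_square)
  then have "expectation (\<lambda>\<omega>. ((\<Sum>i\<in>I. (Z i \<omega>)\<^sup>2) - real (card I))\<^sup>2) =
      (\<Sum>i\<in>I. \<Sum>j\<in>I. if i = j then 2 else 0)"
    using prod by (simp add: Bochner_Integration.integral_sum)
  then show "expectation (\<lambda>\<omega>. ((\<Sum>i\<in>I. (Z i \<omega>)\<^sup>2) - real (card I))\<^sup>2) = 2 * real (card I)"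
    using \<open>finite I\<close> by (simp add: sum.delta)
qed

end

section \<open>The chi-squared law as a law on a product space\<close>

abbreviation gauss :: "real measure" where
  "gauss \<equiv> density lborel (\<lambda>x. ennreal (std_normal_density x))"

text \<open>Random variables are independent if their joint law is the product of their laws; for the
  coordinates of a product space the joint law is the product measure itself.\<close>

lemma indep_std_normal_coordinates:
  assumes "I \<noteq> {}"
  shows "prob_space (\<Pi>\<^sub>M i\<in>I. gauss)"
    and "prob_space.indep_vars (\<Pi>\<^sub>M i\<in>I. gauss) (\<lambda>_. borel) (\<lambda>i z. z i) I"
    and "\<And>i. i \<in> I \<Longrightarrow> std_normal_rv (\<Pi>\<^sub>M i\<in>I. gauss) (\<lambda>z. z i)"
proof -
  have gauss: "prob_space gauss"
    by (rule prob_space_normal_density) simp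
  show prob: "prob_space (\<Pi>\<^sub>M i\<in>I. gauss)"
    by (intro prob_space_PiM gauss)
  have comp: "distr (\<Pi>\<^sub>M i\<in>I. gauss) borel (\<lambda>z. z i) = gauss" if "i \<in> I" for i
    using distr_PiM_component[of I "\<lambda>_. gauss" i] gauss that
    by (metis (no_types, lifting) distr_cong sets_density sets_lborel)
  have [measurable]: "(\<lambda>z. z i) \<in> borel_measurable (\<Pi>\<^sub>M i\<in>I. gauss)" if "i \<in> I" for i
    using measurable_component_singleton[OF that, of "\<lambda>_. gauss"] by simp
  show "std_normal_rv (\<Pi>\<^sub>M i\<in>I. gauss) (\<lambda>z. z i)" if "i \<in> I" for i
    using comp[OF that] that
    by (auto simp: std_normal_rv_def distributed_def cong: distr_cong)
  have "distr (\<Pi>\<^sub>M i\<in>I. gauss) (\<Pi>\<^sub>M i\<in>I. borel) (\<lambda>z. \<lambda>i\<in>I. z i) =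
      distr (\<Pi>\<^sub>M i\<in>I. gauss) (\<Pi>\<^sub>M i\<in>I. gauss) (\<lambda>z. z)"
    by (intro distr_cong sets_PiM_cong) (auto simp: space_PiM)
  also have "\<dots> = (\<Pi>\<^sub>M i\<in>I. distr (\<Pi>\<^sub>M i\<in>I. gauss) borel (\<lambda>z. z i))"
    using comp by (simp add: distr_id cong: PiM_cong)
  finally show "prob_space.indep_vars (\<Pi>\<^sub>M i\<in>I. gauss) (\<lambda>_. borel) (\<lambda>i z. z i) I"
    using assms by (subst prob_space.indep_vars_iff_distr_eq_PiM'[OF prob]) auto
qed

text \<open>Reduces expectations of a chi-squared variable on an arbitrary space to the product space,
  where independent standard normal variables are available as coordinates.\<close>

lemma integral_chi_squared_rv:
  fixes g :: "real \<Rightarrow> real"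
  assumes "chi_squared_rv N R X" and [measurable]: "g \<in> borel_measurable borel"
  shows "(\<integral>\<omega>. g (X \<omega>) \<partial>N) = (\<integral>z. g (\<Sum>i<R. (z i)\<^sup>2) \<partial>(\<Pi>\<^sub>M i\<in>{..<R}. gauss))"
proof -
  have [measurable]: "X \<in> borel_measurable N"
    using assms by (simp add: chi_squared_rv_def)
  have [measurable]: "(\<lambda>z. \<Sum>i<R. (z i)\<^sup>2) \<in> borel_measurable (\<Pi>\<^sub>M i\<in>{..<R}. gauss)"
  proof (intro borel_measurable_sum borel_measurable_power)
    fix i assume "i \<in> {..<R}"
    from measurable_component_singleton[OF this, of "\<lambda>_. gauss"]
    show "(\<lambda>z. z i) \<in> borel_measurable (\<Pi>\<^sub>M i\<in>{..<R}. gauss)" by simp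
  qed
  have "(\<integral>\<omega>. g (X \<omega>) \<partial>N) = (\<integral>x. g x \<partial>distr N borel X)"
    by (subst integral_distr) auto
  also have "\<dots> = (\<integral>z. g (\<Sum>i<R. (z i)\<^sup>2) \<partial>(\<Pi>\<^sub>M i\<in>{..<R}. gauss))"
    using assms(1) unfolding chi_squared_rv_def chi_squared_measure_def
    by (simp, subst integral_distr) auto
  finally show ?thesis .
qed

section \<open>The two cumulants and their ratio\<close>

lemma (in prob_space) cumulant_affine_chi_star:
  assumes indep: "indep_vars (\<lambda>_. borel) Z UNIV" and normal: "\<And>i. std_normal_rv M (Z i)"
    and nonneg: "\<And>i. lam i \<ge> 0" and summ: "summable lam" and pos: "(\<Sum>i. lam i) > 0"
    and "s > 0" "r \<ge> 2"
  shows "cumulant M (\<lambda>\<omega>. (chi_star Z lam \<omega> - a) / s) r = fact r * cgf_coeff lam r / s ^ r"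
proof (rule cumulant_affine)
  fix t :: real
  assume "\<bar>t\<bar> < 1 / (4 * (\<Sum>i. lam i))"
  then have t: "\<bar>t\<bar> * (4 * (\<Sum>i. lam i)) < 1" "\<bar>\<bar>t\<bar>\<bar> * (4 * (\<Sum>i. lam i)) < 1"
    using pos by (simp_all add: field_simps)
  have small: "\<bar>t\<bar> * lam i < 1/2" for i
    using scaled_weight_le[OF nonneg summ t(1), of i] by simp
  show "expectation (\<lambda>\<omega>. exp (t * chi_star Z lam \<omega>)) = exp (\<Sum>k. cgf_coeff lam k * t ^ k)"
    using indep normal nonneg summ small cgf_expansion(2)[OF nonneg summ t(1)]
      cgf_expansion(2)[OF nonneg summ t(2)] by (rule mgf_chi_star)
  show "summable (\<lambda>k. cgf_coeff lam k * t ^ k)"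
    by (rule cgf_expansion(1)[OF nonneg summ t(1)])
qed (use assms in auto)

text \<open>The weights \<open>1, \<dots>, 1, 0, 0, \<dots>\<close> with \<open>R\<close> ones put the chi-squared variable under the same
  power series; mean \<open>R\<close> and variance \<open>2 R\<close> identify the standardization.\<close>

lemma cumulant_standardize_chi_squared:
  assumes X: "chi_squared_rv N R X" and "R > 0" and "r \<ge> 2"
  shows "cumulant N (standardize N X) r = fact r * (2 ^ r / (2 * real r) * real R) / sqrt (2 * real R) ^ r"
proof -
  define P where "P = (\<Pi>\<^sub>M i\<in>{..<R}. gauss)"
  have ne: "{..<R} \<noteq> {}"
    using \<open>R > 0\<close> by auto
  interpret P: prob_space P
    unfolding P_def by (rule indep_std_normal_coordinates[OF ne])
  have indep: "P.indep_vars (\<lambda>_. borel) (\<lambda>i z. z i) {..<R}"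
    and normal: "\<And>i. i \<in> {..<R} \<Longrightarrow> std_normal_rv P (\<lambda>z. z i)"
    unfolding P_def by (rule indep_std_normal_coordinates[OF ne]; assumption?)+
  note law = integral_chi_squared_rv[OF X, folded P_def]
  have mean: "integral\<^sup>L N X = real R"
    using law[of "\<lambda>x. x"] P.sum_squares_moments(1)[OF _ indep normal] by simp
  have var: "(\<integral>\<omega>. (X \<omega> - real R)\<^sup>2 \<partial>N) = 2 * real R"
    using law[of "\<lambda>x. (x - real R)\<^sup>2"] P.sum_squares_moments(2)[OF _ indep normal] by simp
  define lam where "lam i = (if i < R then 1 else 0 :: real)" for i
  have lam_nonneg: "lam i \<ge> 0" for i
    by (simp add: lam_def)
  have lam_sums: "(\<lambda>i. lam i ^ k) sums real R" if "k > 0" for k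
    using sums_If_finite[of "\<lambda>i. i < R" "\<lambda>_. 1::real"] that
    by (simp add: lam_def[abs_def] if_distrib[of "\<lambda>x. x ^ k"] power_0_left cong: if_cong)
  have sum_lam: "summable lam" "(\<Sum>i. lam i) = real R"
    using lam_sums[of 1] by (auto simp: sums_iff)
  have "cumulant N (\<lambda>\<omega>. (X \<omega> - real R) / sqrt (2 * real R)) r =
      fact r * cgf_coeff lam r / sqrt (2 * real R) ^ r"
  proof (rule cumulant_affine)
    fix t :: real
    assume "\<bar>t\<bar> < 1 / (4 * real R)"
    then have t: "\<bar>t\<bar> * (4 * (\<Sum>i. lam i)) < 1"
      using \<open>R > 0\<close> by (simp add: field_simps sum_lam)
    note expansion = cgf_expansion[OF lam_nonneg sum_lam(1) t]
    have "t < 1/2"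
      using scaled_weight_le[OF lam_nonneg sum_lam(1) t, of 0] \<open>R > 0\<close> by (simp add: lam_def)
    have "(\<lambda>i. - ln (1 - 2 * (t * lam i)) / 2) sums (\<Sum>i<R. - ln (1 - 2 * (t * lam i)) / 2)"
      by (intro sums_finite) (auto simp: lam_def)
    then have "(\<Sum>k. cgf_coeff lam k * t ^ k) = (\<Sum>i<R. - ln (1 - 2 * (t * lam i)) / 2)"
      using expansion(2) by (rule sums_unique2[symmetric])
    also have "\<dots> = (\<Sum>i<R. - ln (1 - 2 * t) / 2)"
      by (intro sum.cong) (auto simp: lam_def)
    finally have cgf: "(\<Sum>k. cgf_coeff lam k * t ^ k) = (\<Sum>i<R. - ln (1 - 2 * t) / 2)" .
    have "(\<integral>\<omega>. exp (t * X \<omega>) \<partial>N) = P.expectation (\<lambda>z. exp (\<Sum>i<R. t * (z i)\<^sup>2))"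
      using law[of "\<lambda>x. exp (t * x)"] by (simp add: sum_distrib_left)
    also have "\<dots> = exp (\<Sum>k. cgf_coeff lam k * t ^ k)"
      using P.mgf_finite_sum_squares(2)[OF _ indep normal, of "\<lambda>_. t"] \<open>t < 1/2\<close>
      unfolding cgf by simp
    finally show "(\<integral>\<omega>. exp (t * X \<omega>) \<partial>N) = exp (\<Sum>k. cgf_coeff lam k * t ^ k)" .
    show "summable (\<lambda>k. cgf_coeff lam k * t ^ k)"
      by (rule expansion(1))
  qed (use assms in auto)
  moreover have "cgf_coeff lam r = 2 ^ r / (2 * real r) * real R"
    using lam_sums[of r] \<open>r \<ge> 2\<close> by (simp add: cgf_coeff_def sums_iff)
  ultimately show ?thesis
    by (simp add: standardize_def mean var)
qed

theorem lemma7: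
  fixes M :: "'a measure" and Z :: "nat \<Rightarrow> 'a \<Rightarrow> real"
    and N :: "'b measure" and X :: "'b \<Rightarrow> real"
    and lam :: "nat \<Rightarrow> real" and R r :: nat
  assumes "prob_space M"
    and "prob_space.indep_vars M (\<lambda>_. borel) Z UNIV"
    and "\<And>i. std_normal_rv M (Z i)"
    and "prob_space N"
    and "chi_squared_rv N R X"
    and "R > 0"
    and "\<And>i. lam i \<ge> 0"
    and "\<exists>i. lam i \<noteq> 0"
    and "summable lam"
    and "DOF lam = real R"
    and "r \<ge> 3"
  shows "cumulant M (chi_star_std Z lam) r / cumulant N (standardize N X) r \<ge> 1"
proof -
  define A where "A = (\<Sum>i. lam i)"
  define B where "B = (\<Sum>i. (lam i)\<^sup>2)"
  define C where "C = (\<Sum>i. lam i ^ r)"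
  note powers = summable_power[OF assms(7,9)]
  obtain j where "lam j \<noteq> 0"
    using assms(8) by blast
  then have "lam j > 0"
    using assms(7)[of j] by simp
  then have "A > 0" "B > 0"
    using assms(7) powers[of 2] assms(9) unfolding A_def B_def
    by (auto intro!: suminf_pos2[of _ j])
  have R: "A\<^sup>2 = real R * B"
    using assms(10) \<open>B > 0\<close> by (simp add: DOF_def A_def B_def field_simps)
  interpret M: prob_space M by fact
  have "cumulant M (chi_star_std Z lam) r = fact r * cgf_coeff lam r / sqrt (2 * B) ^ r"
    unfolding chi_star_std_def B_def[symmetric]
    using assms \<open>A > 0\<close> \<open>B > 0\<close> by (intro M.cumulant_affine_chi_star) (auto simp: A_def)
  then have star: "cumulant M (chi_star_std Z lam) r =
      fact r * (2 ^ r / (2 * real r) * C) / (sqrt 2 * sqrt B) ^ r"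
    by (simp add: cgf_coeff_def C_def real_sqrt_mult)
  have "sqrt (real R) * sqrt B = sqrt (A\<^sup>2)"
    by (simp only: R real_sqrt_mult)
  then have root: "sqrt (2 * real R) = sqrt 2 * (A / sqrt B)"
    using \<open>A > 0\<close> \<open>B > 0\<close> by (simp add: real_sqrt_mult field_simps)
  have chi: "cumulant N (standardize N X) r =
      fact r * (2 ^ r / (2 * real r) * real R) / (sqrt 2 * (A / sqrt B)) ^ r"
    using cumulant_standardize_chi_squared[OF assms(5,6)] assms(11) root by simp
  define n where "n = r - 2"
  have r: "r = n + 2"
    using assms(11) by (simp add: n_def)
  have ratio: "cumulant M (chi_star_std Z lam) r / cumulant N (standardize N X) r =
      C / real R * (A / B) ^ r"
  proof -
    (* K is the factor depending on r alone, common to both cumulants. *)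
    define K :: real where "K = fact r * (2 ^ r / (2 * real r))"
    have "K \<noteq> 0"
      using assms(11) by (simp add: K_def)
    have "(sqrt 2 * (A / sqrt B)) ^ r / (sqrt 2 * sqrt B) ^ r = (A / B) ^ r"
      using \<open>B > 0\<close> by (simp flip: power_divide)
    moreover have "K * C / u / (K * real R / v) = C / real R * (v / u)" for u v
      using \<open>K \<noteq> 0\<close> by simp
    ultimately show ?thesis
      unfolding star chi K_def by (simp only: mult.assoc)
  qed
  also have "\<dots> = C * A ^ n / B ^ (n + 1)"
  proof -
    have "real R = A\<^sup>2 / B"
      using R \<open>B > 0\<close> by simp
    then have "C / real R * (A / B) ^ r = C / (A\<^sup>2 / B) * ((A / B) ^ n * (A / B)\<^sup>2)"
      by (simp only: r power_add)
    also have "\<dots> = C * A ^ n / B ^ (n + 1)"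
      using \<open>A > 0\<close> \<open>B > 0\<close> by (simp add: power_divide power2_eq_square)
    finally show ?thesis .
  qed
  finally have "cumulant M (chi_star_std Z lam) r / cumulant N (standardize N X) r =
      C * A ^ n / B ^ (n + 1)" .
  moreover have "B ^ (n + 1) \<le> C * A ^ n"
    unfolding A_def B_def C_def r by (rule power_sum_inequality[OF assms(7,9)])
  ultimately show ?thesis
    using \<open>B > 0\<close> by (simp add: le_divide_eq)
qed

end
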